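(* Suppose $\|g(x)-g(y)\|\le\kappa\|x-y\|$ for all $x,y\in\mathbb{R}^d$ with $\kappa\le 1$, and $\|g'(x)-g'(y)\|\le\gamma\|x-y\|$ for all $x,y\in\mathbb{R}^d$ with $\gamma>0$. Let $\{x_t\}$ be generated by AAP($m$) with $S_t$ and $Y_t$ of full column rank for all $t\ge 0$. Suppose there exist constants $T>0$ and $M>0$ such that, for all $t\ge T$, $J_t$ is invertible, $\sigma_{\min}(Y_t)\ge M\|f_t\|$, and $J_tG_t$ has full column rank. Then, when $f_t$ goes to $0$ (as $t\to\infty$), $$S_tY_t^{\dagger}\to J_t^{-1}\mathcal{P}_{J_tG_t},\qquad H_t\to J_t^{-1}\mathcal{P}_{J_tG_t}-\beta_t\left(I-\mathcal{P}_{J_tG_t}\right),$$ where for two matrix sequences $A_t\to\widetilde A_t$ means $\|A_t-\widetilde A_t\|\to 0$.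
   Context: $g:\mathbb{R}^d\to\mathbb{R}^d$ is continuously differentiable, with Jacobian $g'$, and $f(x):=g(x)-x$. $\|\cdot\|$ is the Euclidean norm for vectors and the induced 2-norm for matrices; $\sigma_{\min}$ is the smallest singular value; $A^\dagger$ is the (left) pseudoinverse; $\mathcal{P}_A:=AA^\dagger$ is the orthogonal projection onto the column space of $A$; $I$ is the identity matrix. AAP($m$) (Alternating Anderson-Picard method), with integer $1\le m\le d$, damping ratios $\beta_t\ge 0$ and starting point $x_0\in\mathbb{R}^d$: for $t=0,1,2,\dots$ set $x_t^0:=x_t$, $x_t^{\ell}:=g(x_t^{\ell-1})$ for $1\le\ell\le m$, $f_t^\ell:=f(x_t^\ell)$ for $0\le\ell\le m$, and $f_t:=f_t^0=f(x_t)$. Let $\alpha_t=(\alpha_t^0,\dots,\alpha_t^m)\in\mathbb{R}^{m+1}$ minimize $\|\sum_{\ell=0}^m\alpha^\ell f_t^\ell\|^2$ subject to $\sum_{\ell=0}^m\alpha^\ell=1$, and set $x_{t+1}:=(1-\beta_t)\sum_{\ell=0}^m\alpha_t^\ell x_t^\ell+\beta_t\sum_{\ell=0}^m\alpha_t^\ell g(x_t^\ell)$. $S_t:=[s_t^0,\dots,s_t^{m-1}]$ and $Y_t:=[y_t^0,\dots,y_t^{m-1}]$ in $\mathbb{R}^{d\times m}$, where $s_t^\ell:=x_t^{\ell+1}-x_t^\ell$ and $y_t^\ell:=f_t^{\ell+1}-f_t^\ell$. $J_t:=f'(x_t)$ and $G_t:=[f_t,\ g'(x_t)f_t,\ g'(x_t)^2f_t,\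 \dots,\ g'(x_t)^{m-1}f_t]\in\mathbb{R}^{d\times m}$ (matrix powers). $H_t:=-\beta_tI+(S_t+\beta_tY_t)(Y_t^TY_t)^{-1}Y_t^T$ is the approximate Jacobian inverse of AAP.
   Formalization: The second limit (for H_t) is stated only for bounded damping ratios β_t; for arbitrary unbounded β_t ≥ 0 it is false, since the projections onto the column spaces of Y_t and J_tG_t in general differ by order ‖f_t‖. The first limit is stated for all β_t ≥ 0. *)

theory Defs
  imports "HOL-Analysis.Analysis"
begin

section \<open>Matrices\<close>

text \<open>The norm of the type \<open>real^'m^'d\<close> is the Frobenius norm; the induced 2-norm is
  the operator norm of the associated linear map.\<close>

definition norm2 :: "real^'m^'d \<Rightarrow> real" where
  "norm2 A = onorm ((*v) A)"

text \<open>The power operation that \<open>real^'d^'d\<close> inherits from the library is componentwise.\<close>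

primrec mat_power :: "real^'d^'d \<Rightarrow> nat \<Rightarrow> real^'d^'d" where
  "mat_power A 0 = mat 1"
| "mat_power A (Suc k) = A ** mat_power A k"

text \<open>Matrices with columns \<open>c 0, \<dots>, c (m - 1)\<close>, where \<open>m = CARD('m)\<close>: the linear order on
  \<open>'m\<close> identifies this type with \<open>{0..<m}\<close>.\<close>

definition col_index :: "'m::{finite,linorder} \<Rightarrow> nat" where
  "col_index j = card {k. k < j}"

definition mat_of_columns :: "(nat \<Rightarrow> real^'d) \<Rightarrow> real^'m::{finite,linorder}^'d" where
  "mat_of_columns c = (\<chi> i j. c (col_index j) $ i)"

definition full_column_rank :: "real^'m^'d \<Rightarrow> bool" where
  "full_column_rank A \<longleftrightarrow> rank A = CARD('m)"

text \<open>Singular values of a matrix with at least as many rows as columns: the square roots of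
  the eigenvalues of \<open>A\<^sup>T A\<close>.\<close>

definition singular_values :: "real^'m^'d \<Rightarrow> real set" where
  "singular_values A =
     {s. s \<ge> 0 \<and> (\<exists>v. v \<noteq> 0 \<and> (transpose A ** A) *v v = s\<^sup>2 *\<^sub>R v)}"

definition sigma_min :: "real^'m^'d \<Rightarrow> real" where
  "sigma_min A = Min (singular_values A)"

text \<open>Left pseudoinverse; meaningful for matrices of full column rank.\<close>

definition pinv :: "real^'m^'d \<Rightarrow> real^'d^'m" where
  "pinv A = matrix_inv (transpose A ** A) ** transpose A"

definition col_proj :: "real^'m^'d \<Rightarrow> real^'d^'d" where
  "col_proj A = A ** pinv A"


section \<open>The Alternating Anderson-Picard method\<close>

definition residual :: "(real^'d \<Rightarrow> real^'d) \<Rightarrow> real^'d \<Rightarrow> real^'d" where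
  "residual g x = g x - x"

text \<open>The Picard iterates of \<open>x\<close> are \<open>(g ^^ l) x\<close>. Coefficient vectors in \<open>\<real>\<^sup>m\<^sup>+\<^sup>1\<close> are functions on
  \<open>nat\<close> of which only the values at \<open>0, \<dots>, m\<close> are used.\<close>

definition mixing_coeffs :: "(real^'d \<Rightarrow> real^'d) \<Rightarrow> nat \<Rightarrow> real^'d \<Rightarrow> (nat \<Rightarrow> real) \<Rightarrow> bool" where
  "mixing_coeffs g m x a \<longleftrightarrow>
     (\<Sum>l\<le>m. a l) = 1 \<and>
     (\<forall>b. (\<Sum>l\<le>m. b l) = 1 \<longrightarrow>
        (norm (\<Sum>l\<le>m. a l *\<^sub>R residual g ((g ^^ l) x)))\<^sup>2
          \<le> (norm (\<Sum>l\<le>m. b l *\<^sub>R residual g ((g ^^ l) x)))\<^sup>2)"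

definition AAP :: "(real^'d \<Rightarrow> real^'d) \<Rightarrow> nat \<Rightarrow> (nat \<Rightarrow> real) \<Rightarrow> (nat \<Rightarrow> nat \<Rightarrow> real)
    \<Rightarrow> (nat \<Rightarrow> real^'d) \<Rightarrow> bool" where
  "AAP g m \<beta> \<alpha> x \<longleftrightarrow>
     (\<forall>t. mixing_coeffs g m (x t) (\<alpha> t) \<and>
          x (Suc t) = (1 - \<beta> t) *\<^sub>R (\<Sum>l\<le>m. \<alpha> t l *\<^sub>R (g ^^ l) (x t))
                    + \<beta> t *\<^sub>R (\<Sum>l\<le>m. \<alpha> t l *\<^sub>R g ((g ^^ l) (x t))))"

definition S_mat :: "(real^'d \<Rightarrow> real^'d) \<Rightarrow> real^'d \<Rightarrow> real^'m::{finite,linorder}^'d" where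
  "S_mat g x = mat_of_columns (\<lambda>l. (g ^^ Suc l) x - (g ^^ l) x)"

definition Y_mat :: "(real^'d \<Rightarrow> real^'d) \<Rightarrow> real^'d \<Rightarrow> real^'m::{finite,linorder}^'d" where
  "Y_mat g x = mat_of_columns (\<lambda>l. residual g ((g ^^ Suc l) x) - residual g ((g ^^ l) x))"

definition J_mat :: "(real^'d \<Rightarrow> real^'d) \<Rightarrow> real^'d \<Rightarrow> real^'d^'d" where
  "J_mat g x = jacobian (residual g) (at x)"

definition G_mat :: "(real^'d \<Rightarrow> real^'d) \<Rightarrow> real^'d \<Rightarrow> real^'m::{finite,linorder}^'d" where
  "G_mat g x = mat_of_columns (\<lambda>l. mat_power (jacobian g (at x)) l *v residual g x)"

definition H_mat :: "real \<Rightarrow> real^'m^'d \<Rightarrow> real^'m^'d \<Rightarrow> real^'d^'d" where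
  "H_mat b S Y = - (b *\<^sub>R mat 1)
     + (S + b *\<^sub>R Y) ** matrix_inv (transpose Y ** Y) ** transpose Y"


section \<open>Convergence of matrix sequences\<close>

definition mat_converges :: "(nat \<Rightarrow> real^'n^'d) \<Rightarrow> (nat \<Rightarrow> real^'n^'d) \<Rightarrow> bool" where
  "mat_converges A B \<longleftrightarrow> (\<lambda>t. norm2 (A t - B t)) \<longlonglongrightarrow> 0"

end

theory Submission
  imports Defs
begin

text \<open>Since \<open>J\<^sup>-\<^sup>1 P\<^bsub>JG\<^esub> = G (JG)\<^sup>\<dagger>\<close>, no bound on \<open>J\<^sub>t\<^sup>-\<^sup>1\<close> is needed: it suffices to compare \<open>S Y\<^sup>\<dagger>\<close> with
  \<open>G (JG)\<^sup>\<dagger>\<close>. The mean value theorem gives \<open>S - G = O(\<parallel>f\<parallel>\<^sup>2)\<close> and \<open>Y - JG = O(\<parallel>f\<parallel>\<^sup>2)\<close>, while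
  \<open>G\<close> and \<open>JG\<close> are \<open>O(\<parallel>f\<parallel>)\<close>. The bound on the smallest singular value makes \<open>Y\<close>, and hence
  eventually \<open>JG\<close>, bounded below by a multiple of \<open>\<parallel>f\<parallel>\<close>, so that \<open>Y\<^sup>\<dagger> = O(1/\<parallel>f\<parallel>)\<close> and, by perturbation
  of the normal equations, \<open>Y\<^sup>\<dagger> - (JG)\<^sup>\<dagger> = O(\<parallel>f\<parallel>\<^sup>2) / \<parallel>f\<parallel>\<^sup>2 = O(1)\<close>. Altogether
  \<open>S Y\<^sup>\<dagger> - G (JG)\<^sup>\<dagger> = O(\<parallel>f\<parallel>)\<close>, and likewise for the projections \<open>Y Y\<^sup>\<dagger>\<close> and \<open>JG (JG)\<^sup>\<dagger>\<close>.\<close>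

section \<open>Operator norm and matrix algebra\<close>

lemma norm2_bound:
  fixes A :: "real^'m^'d"
  assumes "\<And>v. norm (A *v v) \<le> b * norm v"
  shows "norm2 A \<le> b"
  unfolding norm2_def by (rule onorm_le) (rule assms)

lemma norm_mult_vec_le: "norm (A *v v) \<le> norm2 A * norm v" for A :: "real^'m^'d"
  unfolding norm2_def by (rule onorm) (rule matrix_vector_mul_bounded_linear)

lemma norm2_nonneg: "0 \<le> norm2 A" for A :: "real^'m^'d"
  unfolding norm2_def by (rule onorm_pos_le) (rule matrix_vector_mul_bounded_linear)

lemma norm2_mult: "norm2 (A ** B) \<le> norm2 A * norm2 B"
  for A :: "real^'m^'d" and B :: "real^'n^'m"
proof (rule norm2_bound)
  fix v
  have "norm ((A ** B) *v v) \<le> norm2 A * norm (B *v v)"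
    by (metis matrix_vector_mul_assoc norm_mult_vec_le)
  also have "\<dots> \<le> norm2 A * (norm2 B * norm v)"
    by (intro mult_left_mono norm_mult_vec_le norm2_nonneg)
  finally show "norm ((A ** B) *v v) \<le> norm2 A * norm2 B * norm v" by (simp add: mult.assoc)
qed

lemma norm2_add: "norm2 (A + B) \<le> norm2 A + norm2 B" for A B :: "real^'m^'d"
proof (rule norm2_bound)
  fix v
  have "norm ((A + B) *v v) \<le> norm (A *v v) + norm (B *v v)"
    by (simp add: matrix_vector_mult_add_rdistrib norm_triangle_ineq)
  also have "\<dots> \<le> norm2 A * norm v + norm2 B * norm v"
    by (intro add_mono norm_mult_vec_le)
  finally show "norm ((A + B) *v v) \<le> (norm2 A + norm2 B) * norm v" by (simp add: algebra_simps)
qed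

lemma norm2_scaleR: "norm2 (b *\<^sub>R A) \<le> \<bar>b\<bar> * norm2 A" for A :: "real^'m^'d"
proof (rule norm2_bound)
  fix v
  have "norm ((b *\<^sub>R A) *v v) = \<bar>b\<bar> * norm (A *v v)"
    by (simp add: scaleR_matrix_vector_assoc[symmetric])
  also have "\<dots> \<le> \<bar>b\<bar> * (norm2 A * norm v)"
    by (intro mult_left_mono norm_mult_vec_le) auto
  finally show "norm ((b *\<^sub>R A) *v v) \<le> \<bar>b\<bar> * norm2 A * norm v" by (simp add: mult.assoc)
qed

lemma matrix_mult_add_left: "(A + B) ** C = A ** C + B ** C"
  for A B :: "'a::semiring_1^'m^'d" and C :: "'a^'n^'m"
  by (simp add: vec_eq_iff matrix_matrix_mult_def sum.distrib algebra_simps)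

lemma matrix_mult_diff_left: "(A - B) ** C = A ** C - B ** C"
  for A B :: "'a::ring_1^'m^'d" and C :: "'a^'n^'m"
  by (simp add: vec_eq_iff matrix_matrix_mult_def sum_subtractf algebra_simps)

lemma matrix_mult_diff_right: "A ** (B - C) = A ** B - A ** C"
  for A :: "'a::ring_1^'m^'d" and B C :: "'a^'n^'m"
  by (simp add: vec_eq_iff matrix_matrix_mult_def sum_subtractf algebra_simps)

lemma matrix_inv_mult:
  assumes "invertible A"
  shows "A ** matrix_inv A = mat 1" "matrix_inv A ** A = mat 1"
  using someI_ex[OF assms[unfolded invertible_def]] by (auto simp: matrix_inv_def)

lemma inner_transpose_vec: "(transpose A *v x) \<bullet> y = x \<bullet> (A *v y)" for A :: "real^'m^'d"
  by (simp add: dot_lmul_matrix[symmetric] transpose_matrix_vector)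

section \<open>Matrices assembled from columns\<close>

lemma mat_of_columns_mult_vec:
  fixes c :: "nat \<Rightarrow> real^'d" and v :: "real^'m::{finite,linorder}"
  shows "mat_of_columns c *v v = (\<Sum>j\<in>UNIV. v $ j *\<^sub>R c (col_index j))"
  by (simp add: vec_eq_iff matrix_vector_mult_def mat_of_columns_def mult.commute)

lemma col_index_less: "col_index (j :: 'm::{finite,linorder}) < CARD('m)"
  unfolding col_index_def by (rule psubset_card_mono) auto

text \<open>Triangle inequality over the columns with \<open>\<bar>v $ j\<bar> \<le> norm v\<close>.
  The crude factor m is harmless, since m is fixed while the residual tends to 0.\<close>

lemma norm2_mat_of_columns_le:
  fixes c :: "nat \<Rightarrow> real^'d" and b :: real
  assumes "\<And>l. l < CARD('m) \<Longrightarrow> norm (c l) \<le> b"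
  shows "norm2 (mat_of_columns c :: real^'m::{finite,linorder}^'d) \<le> CARD('m) * b"
proof (rule norm2_bound)
  fix v :: "real^'m::{finite,linorder}"
  have "norm (mat_of_columns c *v v) \<le> (\<Sum>j\<in>UNIV. norm (v $ j *\<^sub>R c (col_index j)))"
    unfolding mat_of_columns_mult_vec by (rule norm_sum)
  also have "\<dots> \<le> (\<Sum>j\<in>(UNIV::'m set). norm v * b)"
    by (intro sum_mono) (auto intro!: mult_mono assms col_index_less simp: component_le_norm_cart)
  finally show "norm (mat_of_columns c *v v) \<le> CARD('m) * b * norm v" by (simp add: algebra_simps)
qed

lemma mat_of_columns_diff: "mat_of_columns a - mat_of_columns b = mat_of_columns (\<lambda>l. a l - b l)"
  by (simp add: vec_eq_iff mat_of_columns_def)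

lemma mult_mat_of_columns: "A ** mat_of_columns c = mat_of_columns (\<lambda>l. A *v c l)"
  for A :: "real^'n^'d"
  by (simp add: vec_eq_iff mat_of_columns_def matrix_matrix_mult_def matrix_vector_mult_def)

subsection \<open>Singular values\<close>

text \<open>Makes the \<open>Min\<close> in \<open>sigma_min\<close> meaningful. Eigenvectors of the
  symmetric Gram matrix for distinct eigenvalues are orthogonal, hence independent, and s is
  determined by its square because s is nonnegative.\<close>

lemma finite_singular_values: "finite (singular_values A)" for A :: "real^'m^'d"
proof -
  define N where "N = transpose A ** A"
  have sym: "(N *v x) \<bullet> y = x \<bullet> (N *v y)" for x y
    unfolding N_def
    by (metis inner_commute inner_transpose_vec matrix_vector_mul_assoc)
  have "\<forall>s\<in>singular_values A. \<exists>v. v \<noteq> 0 \<and> N *v v = s\<^sup>2 *\<^sub>R v"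
    unfolding singular_values_def N_def by auto
  then obtain V where V: "\<And>s. s \<in> singular_values A \<Longrightarrow> V s \<noteq> 0 \<and> N *v V s = s\<^sup>2 *\<^sub>R V s"
    by metis
  have orth: "V s \<bullet> V t = 0" if "s \<in> singular_values A" "t \<in> singular_values A" "s \<noteq> t" for s t
  proof -
    have "s\<^sup>2 * (V s \<bullet> V t) = t\<^sup>2 * (V s \<bullet> V t)"
      using sym[of "V s" "V t"] V that by simp
    moreover have "s\<^sup>2 \<noteq> t\<^sup>2"
      using that by (auto simp: singular_values_def power2_eq_iff_nonneg)
    ultimately show ?thesis by simp
  qed
  have inj: "inj_on V (singular_values A)"
    using orth V by (metis inj_onI inner_eq_zero_iff)
  have "pairwise orthogonal (V ` singular_values A)"
    unfolding pairwise_def orthogonal_def using orth by fastforce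
  moreover have "0 \<notin> V ` singular_values A" using V by fastforce
  ultimately have "finite (V ` singular_values A)"
    by (intro finiteI_independent pairwise_orthogonal_independent)
  then show ?thesis using inj finite_imageD by blast
qed

text \<open>First-order optimality condition at t = 0, used for the Rayleigh quotient below.\<close>

lemma real_linear_coeff_zero_if_quadratic_nonneg:
  fixes a b :: real
  assumes "\<And>t. 0 \<le> 2 * t * a + t\<^sup>2 * b"
  shows "a = 0"
proof (rule ccontr)
  assume "a \<noteq> 0"
  \<comment> \<open>B exceeds both b and 0, so at t = -a/B the linear term outweighs the quadratic
    one.\<close>
  define B where "B = \<bar>b\<bar> + 1"
  have "0 \<le> 2 * (-a / B) * a + (-a / B)\<^sup>2 * b" by (rule assms)
  also have "\<dots> = (a\<^sup>2 / B) * (b / B - 2)"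
    by (simp add: power2_eq_square algebra_simps B_def)
  finally have "0 \<le> (a\<^sup>2 / B) * (b / B - 2)" .
  moreover have "a\<^sup>2 / B > 0" "b / B < 2" using \<open>a \<noteq> 0\<close> by (auto simp: B_def field_simps)
  ultimately show False by (metis diff_less_0_iff_less mult_pos_neg not_le)
qed

text \<open>Variational argument: a minimiser u of \<open>norm (A *v u)\<close> on the unit sphere
  is an eigenvector of the Gram matrix, so the minimum s is itself a singular value and bounds
  \<open>sigma_min A\<close> from above.\<close>

lemma sigma_min_le: "sigma_min A * norm v \<le> norm (A *v v)"
  for A :: "real^'m^'d"
proof -
  have "compact (sphere (0::real^'m) 1)" "sphere (0::real^'m) 1 \<noteq> {}" by auto
  moreover have "continuous_on (sphere 0 1) (\<lambda>v. norm (A *v v))"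
    by (intro continuous_intros linear_continuous_on matrix_vector_mul_bounded_linear)
  ultimately obtain u where u: "norm u = 1"
    and umin: "\<And>w. norm w = 1 \<Longrightarrow> norm (A *v u) \<le> norm (A *v w)"
    using continuous_attains_inf[of "sphere 0 1" "\<lambda>v. norm (A *v v)"] by (auto simp: dist_norm)
  define s where "s = norm (A *v u)"
  have min: "s * norm w \<le> norm (A *v w)" for w
  proof (cases "w = 0")
    case False
    have "s \<le> norm (A *v (inverse (norm w) *\<^sub>R w))"
      unfolding s_def by (rule umin) (use False in simp)
    then show ?thesis using False by (simp add: matrix_vector_mult_scaleR field_simps)
  qed simp
  \<comment> \<open>The quadratic in t is \<open>(norm (A *v (u + t *\<^sub>R h)))\<^sup>2 -
    s\<^sup>2 * (norm (u + t *\<^sub>R h))\<^sup>2\<close>. It is nonnegative and its constant term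
    vanishes.\<close>
  have "(A *v u) \<bullet> (A *v h) - s\<^sup>2 * (u \<bullet> h) = 0" for h
  proof (rule real_linear_coeff_zero_if_quadratic_nonneg)
    fix t :: real
    have "(s * norm (u + t *\<^sub>R h))\<^sup>2 \<le> (norm (A *v (u + t *\<^sub>R h)))\<^sup>2"
      by (intro power_mono min) (simp add: s_def)
    moreover have "(norm (u + t *\<^sub>R h))\<^sup>2 = 1 + 2 * t * (u \<bullet> h) + t\<^sup>2 * (h \<bullet> h)"
      using u by (simp only: power2_norm_eq_inner)
        (simp add: inner_simps inner_commute power2_eq_square norm_eq_1 algebra_simps)
    moreover have "(norm (A *v (u + t *\<^sub>R h)))\<^sup>2
        = s\<^sup>2 + 2 * t * ((A *v u) \<bullet> (A *v h)) + t\<^sup>2 * ((A *v h) \<bullet> (A *v h))"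
      unfolding s_def by (simp only: power2_norm_eq_inner matrix_vector_right_distrib matrix_vector_mult_scaleR)
        (simp add: inner_simps inner_commute power2_eq_square algebra_simps)
    ultimately show "0 \<le> 2 * t * ((A *v u) \<bullet> (A *v h) - s\<^sup>2 * (u \<bullet> h))
        + t\<^sup>2 * ((A *v h) \<bullet> (A *v h) - s\<^sup>2 * (h \<bullet> h))"
      by (simp add: power_mult_distrib algebra_simps)
  qed
  then have "((transpose A ** A) *v u - s\<^sup>2 *\<^sub>R u) \<bullet> h = 0" for h
    by (simp add: inner_simps matrix_vector_mul_assoc[symmetric] dot_lmul_matrix)
  then have "(transpose A ** A) *v u = s\<^sup>2 *\<^sub>R u"
    by (metis inner_eq_zero_iff right_minus_eq)
  moreover have "u \<noteq> 0" using u by auto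
  ultimately have "s \<in> singular_values A" by (auto simp: singular_values_def s_def)
  then have "sigma_min A \<le> s" unfolding sigma_min_def by (intro Min_le finite_singular_values)
  then have "sigma_min A * norm v \<le> s * norm v" by (intro mult_right_mono) auto
  then show ?thesis using min by (rule order_trans)
qed

subsection \<open>Perturbation of the pseudoinverse\<close>

text \<open>Quantitative form of full column rank, from which explicit bounds on the pseudoinverse
  follow.\<close>

locale bounded_below_matrix =
  fixes A :: "real^'m^'d" and c :: real
  assumes c_pos: "c > 0" and below: "\<And>v. c * norm v \<le> norm (A *v v)"
begin

lemma gram_right_inverse: "(transpose A ** A) ** matrix_inv (transpose A ** A) = mat 1"
proof -
  have "v = 0" if "(transpose A ** A) *v v = 0" for v
  proof -
    have "(A *v v) \<bullet> (A *v v) = ((transpose A ** A) *v v) \<bullet> v"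
      by (simp add: matrix_vector_mul_assoc[symmetric] dot_lmul_matrix)
    then have "norm (A *v v) = 0" using that by simp
    then show ?thesis using below[of v] c_pos by (simp add: mult_le_0_iff)
  qed
  then have "invertible (transpose A ** A)"
    using matrix_left_invertible_ker invertible_left_inverse by blast
  then show ?thesis by (simp add: matrix_inv_mult)
qed

text \<open>Weak form of the normal equations: the least-squares residual is orthogonal to the
  column space.\<close>

lemma pinv_normal_equation: "(A *v (pinv A *v w)) \<bullet> (A *v v) = w \<bullet> (A *v v)"
proof -
  have "transpose A ** (A ** pinv A) = transpose A"
    unfolding pinv_def by (simp add: matrix_mul_assoc gram_right_inverse)
  then have "transpose A *v (A *v (pinv A *v w)) = transpose A *v w"
    by (simp add: matrix_vector_mul_assoc)
  then show ?thesis by (metis inner_transpose_vec)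
qed

lemma pinv_projection_pythagoras:
  "(norm w)\<^sup>2 = (norm (A *v (pinv A *v w)))\<^sup>2 + (norm (w - A *v (pinv A *v w)))\<^sup>2"
  using pinv_normal_equation[of w "pinv A *v w"]
  by (simp add: power2_norm_eq_inner inner_simps inner_commute)

lemma norm_pinv_projection_le: "norm (A *v (pinv A *v w)) \<le> norm w"
  by (rule power2_le_imp_le) (simp_all add: pinv_projection_pythagoras[of w])

lemma norm_pinv_residual_le: "norm (w - A *v (pinv A *v w)) \<le> norm w"
  by (rule power2_le_imp_le) (simp_all add: pinv_projection_pythagoras[of w])

lemma norm_pinv_vec_le: "norm (pinv A *v w) \<le> norm w / c"
  using order_trans[OF below norm_pinv_projection_le] c_pos by (simp add: field_simps)

lemma norm2_pinv_le: "norm2 (pinv A) \<le> 1 / c"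
  by (rule norm2_bound) (simp add: norm_pinv_vec_le)

end

text \<open>Compares the least-squares solutions p and q of the two problems with the same
  right-hand side w, testing the normal equations with d = p - q. The 2 counts two contributions of
  A - B: one acting on d against the residual r, one acting on q.\<close>

lemma norm2_pinv_diff_le:
  fixes A B :: "real^'m^'d"
  assumes "bounded_below_matrix A c" "bounded_below_matrix B c"
  shows "norm2 (pinv A - pinv B) \<le> 2 * norm2 (A - B) / c\<^sup>2"
proof (rule norm2_bound)
  fix w
  interpret A: bounded_below_matrix A c by fact
  interpret B: bounded_below_matrix B c by fact
  define p where "p = pinv A *v w"
  define q where "q = pinv B *v w"
  define r where "r = w - B *v q"
  define d where "d = p - q"
  define e where "e = norm2 (A - B)"
  have e: "e \<ge> 0" "norm ((A - B) *v v) \<le> e * norm v" for v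
    unfolding e_def by (rule norm2_nonneg) (rule norm_mult_vec_le)
  have r: "norm r \<le> norm w" and q: "norm q \<le> norm w / c"
    unfolding r_def q_def by (rule B.norm_pinv_residual_le) (rule B.norm_pinv_vec_le)
  \<comment> \<open>Orthogonality turns \<open>r \<bullet> (A *v d)\<close> into
    \<open>r \<bullet> ((A - B) *v d)\<close>, so every term of the identity below carries a factor
    A - B.\<close>
  have "r \<bullet> (B *v d) = 0"
    using B.pinv_normal_equation[of w d] by (simp add: r_def q_def inner_simps)
  moreover have "(A *v p) \<bullet> (A *v d) = w \<bullet> (A *v d)"
    unfolding p_def by (rule A.pinv_normal_equation)
  ultimately have "(A *v d) \<bullet> (A *v d) = r \<bullet> ((A - B) *v d) - ((A - B) *v q) \<bullet> (A *v d)"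
    unfolding r_def
    by (simp add: d_def inner_simps matrix_vector_mult_diff_distrib matrix_vector_mult_diff_rdistrib)
  also have "\<dots> \<le> norm r * norm ((A - B) *v d) + norm ((A - B) *v q) * norm (A *v d)"
    using Cauchy_Schwarz_ineq2[of r "(A - B) *v d"]
      Cauchy_Schwarz_ineq2[of "(A - B) *v q" "A *v d"] by linarith
  also have "\<dots> \<le> norm w * (e * (norm (A *v d) / c)) + (e * (norm w / c)) * norm (A *v d)"
  proof (intro add_mono mult_mono)
    have "norm d \<le> norm (A *v d) / c" using A.below[of d] A.c_pos by (simp add: field_simps)
    then have "e * norm d \<le> e * (norm (A *v d) / c)" using e(1) by (rule mult_left_mono)
    then show "norm ((A - B) *v d) \<le> e * (norm (A *v d) / c)" using e(2) order_trans by blast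
    have "e * norm q \<le> e * (norm w / c)" using q e(1) by (rule mult_left_mono)
    then show "norm ((A - B) *v q) \<le> e * (norm w / c)" using e(2) order_trans by blast
  qed (use r e A.c_pos in auto)
  also have "\<dots> = (2 * e * norm w / c) * norm (A *v d)" by simp
  finally have "norm (A *v d) * norm (A *v d) \<le> (2 * e * norm w / c) * norm (A *v d)"
    by (simp add: power2_norm_eq_inner[symmetric] power2_eq_square)
  \<comment> \<open>Cancels one factor \<open>norm (A *v d)\<close>; if it is zero the bound is
    trivial.\<close>
  then have "norm (A *v d) \<le> 2 * e * norm w / c"
    using e(1) A.c_pos mult_right_le_imp_le[of "norm (A *v d)" "norm (A *v d)" "2 * e * norm w / c"]
    by (cases "norm (A *v d) = 0") auto
  then have "c * norm d \<le> 2 * e * norm w / c" using A.below order_trans by blast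
  then have "norm d \<le> 2 * e / c\<^sup>2 * norm w"
    using A.c_pos by (simp add: field_simps power2_eq_square)
  then show "norm ((pinv A - pinv B) *v w) \<le> 2 * norm2 (A - B) / c\<^sup>2 * norm w"
    by (simp add: d_def p_def q_def e_def matrix_vector_mult_diff_rdistrib)
qed

lemma norm2_mult_pinv_diff_le:
  fixes A B :: "real^'m^'d" and P Q :: "real^'m^'n"
  assumes "bounded_below_matrix A c" "bounded_below_matrix B c"
  shows "norm2 (P ** pinv A - Q ** pinv B)
    \<le> norm2 (P - Q) / c + norm2 Q * (2 * norm2 (A - B) / c\<^sup>2)"
proof -
  interpret A: bounded_below_matrix A c by fact
  have "P ** pinv A - Q ** pinv B = (P - Q) ** pinv A + Q ** (pinv A - pinv B)"
    by (simp add: matrix_mult_diff_left matrix_mult_diff_right)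
  then have "norm2 (P ** pinv A - Q ** pinv B)
      \<le> norm2 (P - Q) * norm2 (pinv A) + norm2 Q * norm2 (pinv A - pinv B)"
    using order_trans[OF norm2_add add_mono[OF norm2_mult norm2_mult]] by simp
  also have "\<dots> \<le> norm2 (P - Q) * (1 / c) + norm2 Q * (2 * norm2 (A - B) / c\<^sup>2)"
    by (intro add_mono mult_left_mono A.norm2_pinv_le norm2_pinv_diff_le assms norm2_nonneg)
  finally show ?thesis by simp
qed

text \<open>Counting powers of F, which will be the residual norm: quadratic errors against linear
  lower bounds give F^2/F and F * F^2/F^2, so one power of F survives.\<close>

lemma norm2_mult_pinv_diff_quadratic:
  fixes A B :: "real^'m^'d" and P Q :: "real^'m^'n"
  assumes "bounded_below_matrix A (c * F)" "bounded_below_matrix B (c * F)"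
    and "c > 0" "F > 0"
    and "norm2 (P - Q) \<le> C * F\<^sup>2" "norm2 (A - B) \<le> C * F\<^sup>2" "norm2 Q \<le> D * F"
  shows "norm2 (P ** pinv A - Q ** pinv B) \<le> (C / c + 2 * C * D / c\<^sup>2) * F"
proof -
  have "norm2 (P ** pinv A - Q ** pinv B)
      \<le> norm2 (P - Q) / (c * F) + norm2 Q * (2 * norm2 (A - B) / (c * F)\<^sup>2)"
    by (rule norm2_mult_pinv_diff_le) fact+
  also have "\<dots> \<le> (C * F\<^sup>2) / (c * F) + (D * F) * (2 * (C * F\<^sup>2) / (c * F)\<^sup>2)"
    using assms norm2_nonneg[of Q] norm2_nonneg[of "A - B"]
    by (intro add_mono mult_mono divide_right_mono) auto
  also have "\<dots> = (C / c + 2 * C * D / c\<^sup>2) * F"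
    using assms(3,4) by (simp add: field_simps power2_eq_square)
  finally show ?thesis .
qed

subsection \<open>Linearisation of the Picard iterates\<close>

lemma norm_derivative_le_if_nonexpansive:
  fixes g :: "'a::real_normed_vector \<Rightarrow> 'b::real_normed_vector"
  assumes "(g has_derivative D) (at z)" and "\<And>y z. norm (g y - g z) \<le> norm (y - z)"
  shows "norm (D v) \<le> norm v"
proof (cases "v = 0")
  case True
  then show ?thesis using assms(1) using has_derivative_linear linear_0 by force
next
  case False
  interpret D: bounded_linear D using assms(1) by (rule has_derivative_bounded_linear)
  have "norm (D v) / norm v \<le> 1"
  proof (rule field_le_epsilon)
    fix e :: real assume "e > 0"
    then obtain d where "d > 0"
      and d: "\<And>y. norm (y - z) < d \<Longrightarrow> norm (g y - g z - D (y - z)) \<le> e * norm (y - z)"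
      using assms(1) unfolding has_derivative_at_alt by blast
    \<comment> \<open>Scales v to length d/2, inside the neighbourhood where the derivative estimate
      holds.\<close>
    define s where "s = d / (2 * norm v)"
    have s: "s > 0" "norm (s *\<^sub>R v) < d" using \<open>d > 0\<close> False by (auto simp: s_def)
    have "norm (g (z + s *\<^sub>R v) - g z - D (s *\<^sub>R v)) \<le> e * norm (s *\<^sub>R v)"
      using d[of "z + s *\<^sub>R v"] s by simp
    moreover have "norm (g (z + s *\<^sub>R v) - g z) \<le> norm (s *\<^sub>R v)"
      using assms(2)[of "z + s *\<^sub>R v" z] by simp
    ultimately have "norm (D (s *\<^sub>R v)) \<le> (1 + e) * norm (s *\<^sub>R v)"
      using norm_triangle_ineq2[of "D (s *\<^sub>R v)" "g (z + s *\<^sub>R v) - g z"]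
      by (simp add: norm_minus_commute algebra_simps)
    then have "s * norm (D v) \<le> s * ((1 + e) * norm v)" using s by (simp add: D.scaleR algebra_simps)
    then have "norm (D v) \<le> (1 + e) * norm v" using s by simp
    then show "norm (D v) / norm v \<le> 1 + e" using False by (simp add: field_simps)
  qed
  then show ?thesis using False by (simp add: field_simps)
qed

locale nonexpansive_C1 =
  fixes g :: "real^'d \<Rightarrow> real^'d" and \<gamma> :: real
  assumes diff: "\<And>z. g differentiable (at z)"
    and nonexp: "\<And>y z. norm (g y - g z) \<le> norm (y - z)"
    and lip': "\<And>y z. norm2 (jacobian g (at y) - jacobian g (at z)) \<le> \<gamma> * norm (y - z)"
    and gamma: "\<gamma> > 0"
begin

lemma deriv: "(g has_derivative (\<lambda>h. jacobian g (at z) *v h)) (at z)"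
  using diff jacobian_works by blast

lemma norm_jacobian_vec_le: "norm (jacobian g (at z) *v v) \<le> norm v"
  using deriv nonexp by (rule norm_derivative_le_if_nonexpansive)

lemma J_mat_eq: "J_mat g z = jacobian g (at z) - mat 1"
proof -
  have "(residual g has_derivative (\<lambda>h. (jacobian g (at z) - mat 1) *v h)) (at z)"
    unfolding residual_def[abs_def] matrix_vector_mult_diff_rdistrib matrix_vector_mul_lid
    by (intro derivative_intros deriv)
  then have "frechet_derivative (residual g) (at z) = (*v) (jacobian g (at z) - mat 1)"
    using frechet_derivative_at by metis
  then show ?thesis by (simp add: J_mat_def jacobian_def matrix_of_matrix_vector_mul)
qed

lemma norm_mat_power_vec_le: "norm (mat_power (jacobian g (at z)) l *v v) \<le> norm v"
proof (induction l)
  case (Suc l)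
  show ?case
    using order_trans[OF norm_jacobian_vec_le Suc]
    by (simp add: matrix_vector_mul_assoc[symmetric])
qed simp

lemma norm_Picard_step_le: "norm ((g ^^ Suc l) x - (g ^^ l) x) \<le> norm (residual g x)"
proof (induction l)
  case (Suc l)
  show ?case using order_trans[OF nonexp Suc] by simp
qed (simp add: residual_def)

lemma dist_Picard_le: "norm ((g ^^ l) x - x) \<le> l * norm (residual g x)"
proof (induction l)
  case (Suc l)
  have "norm ((g ^^ Suc l) x - x) \<le> norm ((g ^^ Suc l) x - (g ^^ l) x) + norm ((g ^^ l) x - x)"
    using norm_triangle_ineq[of "(g ^^ Suc l) x - (g ^^ l) x" "(g ^^ l) x - x"] by simp
  also have "\<dots> \<le> norm (residual g x) + l * norm (residual g x)"
    using norm_Picard_step_le[of l x] Suc by (rule add_mono)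
  finally show ?case by (simp add: algebra_simps)
qed simp

text \<open>Mean value inequality on the segment from a to b. It lies in the ball of radius r about
  x, where the Jacobian differs from its value at x by at most \<gamma> r.\<close>

lemma linearization_error:
  assumes "norm (a - x) \<le> r" "norm (b - x) \<le> r"
  shows "norm (g b - g a - jacobian g (at x) *v (b - a)) \<le> norm (b - a) * (\<gamma> * r)"
proof (rule differentiable_bound_linearization[where S = "cball x r" and f' = "\<lambda>z h. jacobian g (at z) *v h"])
  have ab: "a \<in> cball x r" "b \<in> cball x r" using assms by (auto simp: dist_norm norm_minus_commute)
  show "a + t *\<^sub>R (b - a) \<in> cball x r" if "t \<in> {0..1}" for t
    using convexD_alt[OF convex_cball ab, of t] that by (simp add: algebra_simps)
  show "(g has_derivative (\<lambda>h. jacobian g (at z) *v h)) (at z within cball x r)" for z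
    by (rule has_derivative_at_withinI) (rule deriv)
  show "onorm ((\<lambda>h. jacobian g (at z) *v h) - (\<lambda>h. jacobian g (at x) *v h)) \<le> \<gamma> * r"
    if "z \<in> cball x r" for z
  proof -
    have "norm2 (jacobian g (at z) - jacobian g (at x)) \<le> \<gamma> * norm (z - x)" by (rule lip')
    also have "\<dots> \<le> \<gamma> * r" using that gamma by (simp add: dist_norm norm_minus_commute)
    finally show ?thesis
      by (simp add: norm2_def matrix_vector_mult_diff_rdistrib[abs_def] fun_diff_def)
  qed
  show "x \<in> cball x r" using assms norm_ge_zero order_trans by (simp, blast)
qed

text \<open>The error of step l + 1 is a fresh linearisation error, at most \<gamma> (l + 1) F^2,
  plus the Jacobian applied to the previous error, which does not enlarge it. The factor l^2
  satisfies this recursion because l^2 + l + 1 \<le> (l + 1)^2.\<close>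

lemma Picard_step_error:
  "norm ((g ^^ Suc l) x - (g ^^ l) x - mat_power (jacobian g (at x)) l *v residual g x)
    \<le> \<gamma> * real l ^ 2 * (norm (residual g x))\<^sup>2"
proof (induction l)
  case (Suc l)
  define D where "D = jacobian g (at x)"
  define F where "F = norm (residual g x)"
  define a where "a = (g ^^ l) x"
  define b where "b = (g ^^ Suc l) x"
  have F: "F \<ge> 0" by (simp add: F_def)
  \<comment> \<open>Common radius for both endpoints, dictated by the farther iterate b.\<close>
  have a: "norm (a - x) \<le> (real l + 1) * F"
    using dist_Picard_le[of l x] F unfolding a_def F_def[symmetric] by (simp add: algebra_simps)
  have b: "norm (b - x) \<le> (real l + 1) * F"
    using dist_Picard_le[of "Suc l" x] unfolding b_def F_def by (simp add: algebra_simps)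
  have ba: "norm (b - a) \<le> F" unfolding a_def b_def F_def by (rule norm_Picard_step_le)
  have "norm (g b - g a - D *v (b - a)) \<le> norm (b - a) * (\<gamma> * ((real l + 1) * F))"
    unfolding D_def using a b by (rule linearization_error)
  also have "\<dots> \<le> F * (\<gamma> * ((real l + 1) * F))"
    using ba gamma F by (intro mult_right_mono) auto
  finally have 1: "norm (g b - g a - D *v (b - a)) \<le> \<gamma> * (real l + 1) * F\<^sup>2"
    by (simp add: power2_eq_square algebra_simps)
  have "norm (D *v (b - a - mat_power D l *v residual g x))
      \<le> norm (b - a - mat_power D l *v residual g x)"
    unfolding D_def by (rule norm_jacobian_vec_le)
  also have "\<dots> \<le> \<gamma> * real l ^ 2 * F\<^sup>2" using Suc unfolding a_def b_def D_def F_def .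
  finally have 2: "norm (D *v (b - a - mat_power D l *v residual g x))
      \<le> \<gamma> * real l ^ 2 * F\<^sup>2" .
  have "g b - g a - mat_power D (Suc l) *v residual g x
      = (g b - g a - D *v (b - a)) + D *v (b - a - mat_power D l *v residual g x)"
    by (simp add: matrix_vector_mult_diff_distrib matrix_vector_mul_assoc)
  then have "norm (g b - g a - mat_power D (Suc l) *v residual g x)
      \<le> \<gamma> * (real l + 1) * F\<^sup>2 + \<gamma> * real l ^ 2 * F\<^sup>2"
    using norm_triangle_mono[OF 1 2] by (simp only:)
  also have "\<dots> = \<gamma> * F\<^sup>2 * (real l + 1 + real l ^ 2)" by (simp add: algebra_simps)
  also have "\<dots> \<le> \<gamma> * F\<^sup>2 * real (Suc l) ^ 2"
    using gamma by (intro mult_left_mono) (simp_all add: power2_eq_square distrib_left distrib_right)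
  finally show ?case by (simp add: a_def b_def D_def F_def algebra_simps)
qed (simp add: residual_def)

lemma Picard_step_error':
  assumes "l \<le> n"
  shows "norm ((g ^^ Suc l) x - (g ^^ l) x - mat_power (jacobian g (at x)) l *v residual g x)
    \<le> \<gamma> * real n ^ 2 * (norm (residual g x))\<^sup>2"
  by (rule order_trans[OF Picard_step_error])
    (use assms gamma in \<open>intro mult_right_mono mult_left_mono power_mono; simp\<close>)

text \<open>Since J = g' - I, the columns of JG are differences of consecutive Krylov vectors, just
  as those of Y are differences of consecutive Picard steps.\<close>

lemma J_mat_mult_G_mat: "J_mat g x ** G_mat g x
    = mat_of_columns (\<lambda>l. mat_power (jacobian g (at x)) (Suc l) *v residual g x
        - mat_power (jacobian g (at x)) l *v residual g x)"
  by (simp add: J_mat_eq G_mat_def mult_mat_of_columns matrix_vector_mult_diff_rdistrib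
      matrix_mult_diff_left matrix_vector_mul_assoc)

text \<open>The slack factor 2 matches the bound for JG, so that one constant serves both.\<close>

lemma norm2_G_mat_le:
  "norm2 (G_mat g x :: real^'m::{finite,linorder}^'d) \<le> 2 * real CARD('m) * norm (residual g x)"
proof -
  have "norm2 (G_mat g x :: real^'m::{finite,linorder}^'d) \<le> real CARD('m) * norm (residual g x)"
    unfolding G_mat_def by (intro norm2_mat_of_columns_le norm_mat_power_vec_le)
  then show ?thesis by (simp add: norm2_nonneg order_trans)
qed

lemma norm2_J_mat_mult_G_mat_le:
  "norm2 (J_mat g x ** (G_mat g x :: real^'m::{finite,linorder}^'d))
    \<le> 2 * real CARD('m) * norm (residual g x)"
proof -
  have "norm2 (J_mat g x ** (G_mat g x :: real^'m::{finite,linorder}^'d))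
      \<le> real CARD('m) * (2 * norm (residual g x))"
    unfolding J_mat_mult_G_mat
  proof (rule norm2_mat_of_columns_le)
    fix l
    show "norm (mat_power (jacobian g (at x)) (Suc l) *v residual g x
        - mat_power (jacobian g (at x)) l *v residual g x) \<le> 2 * norm (residual g x)"
      using norm_triangle_ineq4 norm_mat_power_vec_le[of x "Suc l" "residual g x"]
        norm_mat_power_vec_le[of x l "residual g x"] by (smt (verit))
  qed
  then show ?thesis by simp
qed

text \<open>Columnwise Picard step errors; the factor 2 is again slack, matching the bound for Y -
  JG.\<close>

lemma norm2_S_mat_diff_G_mat_le:
  "norm2 (S_mat g x - G_mat g x :: real^'m::{finite,linorder}^'d)
    \<le> 2 * \<gamma> * real CARD('m) ^ 3 * (norm (residual g x))\<^sup>2"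
proof -
  have "norm2 (S_mat g x - G_mat g x :: real^'m::{finite,linorder}^'d)
      \<le> real CARD('m) * (\<gamma> * real CARD('m) ^ 2 * (norm (residual g x))\<^sup>2)"
    unfolding S_mat_def G_mat_def mat_of_columns_diff
    by (intro norm2_mat_of_columns_le Picard_step_error') simp
  also have "\<dots> \<le> 2 * (real CARD('m) * (\<gamma> * real CARD('m) ^ 2 * (norm (residual g x))\<^sup>2))"
    using gamma by simp
  finally show ?thesis by (simp add: power2_eq_square power3_eq_cube mult_ac)
qed

lemma norm2_Y_mat_diff_le:
  "norm2 (Y_mat g x - J_mat g x ** G_mat g x :: real^'m::{finite,linorder}^'d)
    \<le> 2 * \<gamma> * real CARD('m) ^ 3 * (norm (residual g x))\<^sup>2"
proof -
  define D where "D = jacobian g (at x)"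
  define n where "n = CARD('m)"
  define F where "F = norm (residual g x)"
  have "norm2 (Y_mat g x - J_mat g x ** G_mat g x :: real^'m::{finite,linorder}^'d)
      \<le> real CARD('m) * (2 * (\<gamma> * real n ^ 2 * F\<^sup>2))"
    unfolding Y_mat_def J_mat_mult_G_mat mat_of_columns_diff
  proof (rule norm2_mat_of_columns_le)
    fix l assume "l < CARD('m)"
    \<comment> \<open>Column l of Y involves the Picard steps l and l + 1, so step errors are used
      up to index m itself.\<close>
    then have "l \<le> n" "Suc l \<le> n" by (auto simp: n_def)
    note err = this[THEN Picard_step_error', of x, folded D_def F_def]
    have "residual g ((g ^^ Suc l) x) - residual g ((g ^^ l) x)
        - (mat_power D (Suc l) *v residual g x - mat_power D l *v residual g x)
      = ((g ^^ Suc (Suc l)) x - (g ^^ Suc l) x - mat_power D (Suc l) *v residual g x)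
        - ((g ^^ Suc l) x - (g ^^ l) x - mat_power D l *v residual g x)"
      by (simp add: residual_def)
    also have "norm \<dots> \<le> \<gamma> * real n ^ 2 * F\<^sup>2 + \<gamma> * real n ^ 2 * F\<^sup>2"
      by (rule order_trans[OF norm_triangle_ineq4 add_mono[OF err(2) err(1)]])
    finally show "norm (residual g ((g ^^ Suc l) x) - residual g ((g ^^ l) x)
        - (mat_power (jacobian g (at x)) (Suc l) *v residual g x
           - mat_power (jacobian g (at x)) l *v residual g x)) \<le> 2 * (\<gamma> * real n ^ 2 * F\<^sup>2)"
      unfolding D_def by (simp add: mult_ac)
  qed
  then show ?thesis by (simp add: n_def F_def power2_eq_square power3_eq_cube mult_ac)
qed

end

section \<open>Assembly of the two limits\<close>

text \<open>Reduces the limit of H to that of \<open>S ** pinv Y\<close> and of the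
  projections.\<close>

lemma H_mat_eq: "H_mat b S Y = S ** pinv Y - b *\<^sub>R (mat 1 - col_proj Y)"
  for S Y :: "real^'m^'d"
proof -
  have "(b *\<^sub>R Y) ** Z = b *\<^sub>R (Y ** Z)" for Z :: "real^'d^'m"
    by (simp add: scalar_matrix_assoc)
  then show ?thesis
    by (simp add: H_mat_def pinv_def col_proj_def matrix_mult_add_left matrix_mul_assoc[symmetric]
        algebra_simps)
qed

theorem theorem4p5:
  fixes g :: "real^'d \<Rightarrow> real^'d"
    and \<kappa> \<gamma> :: real
    and \<beta> :: "nat \<Rightarrow> real"
    and \<alpha> :: "nat \<Rightarrow> nat \<Rightarrow> real"
    and x f :: "nat \<Rightarrow> real^'d"
    and S Y G :: "nat \<Rightarrow> real^'m::{finite,linorder}^'d"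
    and J H :: "nat \<Rightarrow> real^'d^'d"
  assumes g_diff: "\<And>z. g differentiable (at z)"
    and g_C1: "continuous_on UNIV (\<lambda>z. jacobian g (at z))"
    and m_le_d: "CARD('m) \<le> CARD('d)"
    and lip: "\<And>y z. norm (g y - g z) \<le> \<kappa> * norm (y - z)"
    and kappa: "\<kappa> \<le> 1"
    and lip': "\<And>y z. norm2 (jacobian g (at y) - jacobian g (at z)) \<le> \<gamma> * norm (y - z)"
    and gamma: "\<gamma> > 0"
    and beta: "\<And>t. \<beta> t \<ge> 0"
    and aap: "AAP g CARD('m) \<beta> \<alpha> x"
    and f: "\<And>t. f t = residual g (x t)"
    and S: "\<And>t. S t = S_mat g (x t)"
    and Y: "\<And>t. Y t = Y_mat g (x t)"
    and J: "\<And>t. J t = J_mat g (x t)"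
    and G: "\<And>t. G t = G_mat g (x t)"
    and H: "\<And>t. H t = H_mat (\<beta> t) (S t) (Y t)"
    and S_rank: "\<And>t. full_column_rank (S t)"
    and Y_rank: "\<And>t. full_column_rank (Y t)"
    and regular: "\<exists>T::nat>0. \<exists>M::real>0. \<forall>t\<ge>T. invertible (J t) \<and> sigma_min (Y t) \<ge> M * norm (f t)
                    \<and> full_column_rank (J t ** G t)"
    and f_lim: "f \<longlonglongrightarrow> 0"
  shows "mat_converges (\<lambda>t. S t ** pinv (Y t))
           (\<lambda>t. matrix_inv (J t) ** col_proj (J t ** G t))
       \<and> (bounded (range \<beta>) \<longrightarrow>
            mat_converges H
              (\<lambda>t. matrix_inv (J t) ** col_proj (J t ** G t)
                   - \<beta> t *\<^sub>R (mat 1 - col_proj (J t ** G t))))"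
proof -
  interpret nonexpansive_C1 g \<gamma>
  proof
    show "norm (g y - g z) \<le> norm (y - z)" for y z
      using order_trans[OF lip mult_right_mono[OF kappa]] by simp
  qed (use g_diff lip' gamma in auto)
  obtain T M where "M > 0" and inv: "\<And>t. t \<ge> T \<Longrightarrow> invertible (J t)"
    and sigma: "\<And>t. t \<ge> T \<Longrightarrow> M * norm (f t) \<le> sigma_min (Y t)"
    and rank: "\<And>t. t \<ge> T \<Longrightarrow> full_column_rank (J t ** G t)"
    using regular by blast
  define C where "C = 2 * \<gamma> * real CARD('m) ^ 3"
  define D where "D = 2 * real CARD('m)"
  \<comment> \<open>Half of M: the other half absorbs the perturbation from Y to JG.\<close>
  define c where "c = M / 2"
  define K where "K = C / c + 2 * C * D / c\<^sup>2"
  have "C > 0" "D > 0" "c > 0" using gamma \<open>M > 0\<close> by (auto simp: C_def D_def c_def)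
  then have "K > 0" by (simp add: K_def add_pos_pos)
  have "(\<lambda>t. C * norm (f t)) \<longlonglongrightarrow> C * 0"
    by (intro tendsto_intros tendsto_norm_zero f_lim)
  \<comment> \<open>Eventually the perturbation C F^2 is smaller than c F.\<close>
  then have "\<forall>\<^sub>F t in sequentially. C * norm (f t) < c"
    using \<open>c > 0\<close> by (simp add: order_tendstoD(2))
  then have ev: "\<forall>\<^sub>F t in sequentially.
      norm2 (S t ** pinv (Y t) - matrix_inv (J t) ** col_proj (J t ** G t)) \<le> K * norm (f t)
      \<and> norm2 (col_proj (Y t) - col_proj (J t ** G t)) \<le> K * norm (f t)"
    using eventually_ge_at_top[of T]
  proof eventually_elim
    case (elim t)
    define F where "F = norm (f t)"
    have SG: "norm2 (S t - G t) \<le> C * F\<^sup>2" and YJG: "norm2 (Y t - J t ** G t) \<le> C * F\<^sup>2"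
      and Gb: "norm2 (G t) \<le> D * F" and JGb: "norm2 (J t ** G t) \<le> D * F"
      unfolding S G Y J F_def f C_def D_def
      by (rule norm2_S_mat_diff_G_mat_le norm2_Y_mat_diff_le norm2_G_mat_le
          norm2_J_mat_mult_G_mat_le)+
    \<comment> \<open>Needed for dividing by F. A zero residual would make every column of JG
      vanish, contradicting its full column rank, as m \<ge> 1.\<close>
    have "F > 0"
    proof (rule ccontr)
      assume "\<not> F > 0"
      then have "residual g (x t) = 0" by (simp add: F_def f)
      then have "J t ** G t = 0"
        by (simp add: J G J_mat_mult_G_mat) (simp add: mat_of_columns_def vec_eq_iff)
      then show False using rank[of t] elim by (simp add: full_column_rank_def)
    qed
    have Yb: "2 * c * F * norm v \<le> norm (Y t *v v)" for v
    proof -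
      have "2 * c * F * norm v \<le> sigma_min (Y t) * norm v"
        using sigma[of t] elim by (intro mult_right_mono) (auto simp: F_def c_def)
      then show ?thesis using sigma_min_le order_trans by blast
    qed
    have Y': "bounded_below_matrix (Y t) (c * F)"
    proof
      show "c * F * norm v \<le> norm (Y t *v v)" for v
        by (rule order_trans[OF _ Yb]) (use \<open>c > 0\<close> \<open>F > 0\<close> in simp)
    qed (use \<open>c > 0\<close> \<open>F > 0\<close> in simp)
    \<comment> \<open>Reverse triangle inequality: of the lower bound 2 c F for Y, at most c F is
      lost in passing to JG.\<close>
    have JG': "bounded_below_matrix (J t ** G t) (c * F)"
    proof
      fix v
      have "norm ((Y t - J t ** G t) *v v) \<le> norm2 (Y t - J t ** G t) * norm v"
        by (rule norm_mult_vec_le)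
      also have "\<dots> \<le> (C * F\<^sup>2) * norm v" by (intro mult_right_mono YJG) simp
      also have "\<dots> = (C * F) * (F * norm v)" by (simp add: power2_eq_square)
      also have "\<dots> \<le> c * (F * norm v)"
        using elim(1) \<open>F > 0\<close> unfolding F_def by (intro mult_right_mono) auto
      finally have "norm (Y t *v v - (J t ** G t) *v v) \<le> c * F * norm v"
        by (simp add: matrix_vector_mult_diff_rdistrib mult.assoc)
      then show "c * F * norm v \<le> norm ((J t ** G t) *v v)"
        using Yb[of v] norm_triangle_ineq2[of "Y t *v v" "(J t ** G t) *v v"] by linarith
    qed (use \<open>c > 0\<close> \<open>F > 0\<close> in simp)
    \<comment> \<open>Cancelling J removes its inverse from the target, so no bound on that inverse
      enters.\<close>
    have "matrix_inv (J t) ** J t = mat 1" using inv[of t] elim by (simp add: matrix_inv_mult)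
    then have "matrix_inv (J t) ** col_proj (J t ** G t) = G t ** pinv (J t ** G t)"
      by (simp add: col_proj_def matrix_mul_assoc)
    then show ?case
      unfolding col_proj_def K_def F_def[symmetric]
      \<comment> \<open>Applied twice with the same constants: with P = S, Q = G for the first
        limit, and with P = Y, Q = JG for the projections.\<close>
      using norm2_mult_pinv_diff_quadratic[OF Y' JG' \<open>c > 0\<close> \<open>F > 0\<close> SG YJG Gb]
        norm2_mult_pinv_diff_quadratic[OF Y' JG' \<open>c > 0\<close> \<open>F > 0\<close> YJG YJG JGb]
      by (simp add: col_proj_def)
  qed
  have lim: "(\<lambda>t. L * norm (f t)) \<longlonglongrightarrow> 0" for L
    using tendsto_mult_right_zero[OF tendsto_norm_zero[OF f_lim]] .
  show ?thesis
  proof (intro conjI impI)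
    show "mat_converges (\<lambda>t. S t ** pinv (Y t)) (\<lambda>t. matrix_inv (J t) ** col_proj (J t ** G t))"
      unfolding mat_converges_def
      by (rule tendsto_sandwich[OF _ _ tendsto_const lim[of K]])
        (use ev in \<open>auto simp: norm2_nonneg elim: eventually_mono\<close>)
  next
    \<comment> \<open>The projection error is O(F) but enters H multiplied by
      \<open>\<beta> t\<close>; a uniform bound b keeps the product O(F).\<close>
    assume "bounded (range \<beta>)"
    then obtain b where b: "\<And>t. \<bar>\<beta> t\<bar> \<le> b" unfolding bounded_iff by auto
    have "\<forall>\<^sub>F t in sequentially. norm2 (H t - (matrix_inv (J t) ** col_proj (J t ** G t)
        - \<beta> t *\<^sub>R (mat 1 - col_proj (J t ** G t)))) \<le> (K + b * K) * norm (f t)"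
      using ev
    proof eventually_elim
      case (elim t)
      have "H t - (matrix_inv (J t) ** col_proj (J t ** G t)
          - \<beta> t *\<^sub>R (mat 1 - col_proj (J t ** G t)))
        = (S t ** pinv (Y t) - matrix_inv (J t) ** col_proj (J t ** G t))
          + \<beta> t *\<^sub>R (col_proj (Y t) - col_proj (J t ** G t))"
        by (simp add: H H_mat_eq algebra_simps)
      also have "norm2 \<dots> \<le> norm2 (S t ** pinv (Y t) - matrix_inv (J t) ** col_proj (J t ** G t))
          + \<bar>\<beta> t\<bar> * norm2 (col_proj (Y t) - col_proj (J t ** G t))"
        by (rule order_trans[OF norm2_add add_left_mono[OF norm2_scaleR]])
      also have "\<dots> \<le> K * norm (f t) + b * (K * norm (f t))"
        using elim b[of t] order_trans[OF abs_ge_zero b[of t]]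
        by (intro add_mono mult_mono) (auto simp: norm2_nonneg)
      finally show ?case by (simp add: algebra_simps)
    qed
    then show "mat_converges H (\<lambda>t. matrix_inv (J t) ** col_proj (J t ** G t)
        - \<beta> t *\<^sub>R (mat 1 - col_proj (J t ** G t)))"
      unfolding mat_converges_def
      by (intro tendsto_sandwich[OF _ _ tendsto_const lim[of "K + b * K"]])
        (auto simp: norm2_nonneg)
  qed
qed

end
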